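(* Consider the system $x_{t+1}=Ax_t+Bu_t+Le_t$, $y_t=Cx_t+Du_t+e_t$ over the horizon $t=0,\dots,T$, in its stacked form $\mathbf{y}=\mathbf{G}\mathbf{u}+\mathbf{y}_0+\Theta\mathbf{e}$ (with $\mathbf{G},\mathbf{y}_0,\Theta$ as defined in the context), under strictly causal affine output-feedback policies $\mathbf{u}=\mathbf{K}\mathbf{y}+\mathbf{p}$, where $\mathbf{K}\in\mathbb{R}^{m(T+1)\times q(T+1)}$ is block strictly-lower-triangular and $\mathbf{p}\in\mathbb{R}^{m(T+1)}$. For $\Phi_y\in\mathbb{R}^{q(T+1)\times q(T+1)}$, $\Phi_u\in\mathbb{R}^{m(T+1)\times q(T+1)}$, $\phi_y\in\mathbb{R}^{q(T+1)}$, $\phi_u\in\mathbb{R}^{m(T+1)}$ consider the conditions: (S) $\begin{bmatrix} I & -\mathbf{G}\end{bmatrix}\begin{bmatrix}\Phi_y&\phi_y\\ \Phi_u&\phi_u\end{bmatrix}=\begin{bmatrix} I & 0\end{bmatrix}$; (L) $\Phi_y$ is block-lower-triangular and $\Phi_u$ is block strictly-lower-triangular; (R) $\begin{bmatrix}\mathbf{y}\\ \mathbf{u}\end{bmatrix}=\begin{bmatrix}\Phi_y&\phi_y\\ \Phi_u&\phi_u\end{bmatrix}\begin{bmatrix}\mathbf{y}_0+\Theta\mathbf{e}\\ 1\end{bmatrix}$. Then the following hold. 1) The affine subspace defined by (S) and (L) parameterizes all possible closed-loop output-input responses in the form (R). Namely, for every block strictly-lower-triangular $\mathbf{K}$ and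 every $\mathbf{p}$, the closed-loop response has the form (R) (for all $\mathbf{e}$) with some $(\Phi_y,\Phi_u,\phi_y,\phi_u)$ satisfying (S) and (L); and every $(\Phi_y,\Phi_u,\phi_y,\phi_u)$ satisfying (L) for which (R) is, for all $\mathbf{e}$, the closed-loop response of some such policy $(\mathbf{K},\mathbf{p})$ satisfies (S). 2) For any $(\Phi_y,\Phi_u,\phi_y,\phi_u)$ satisfying (S) and (L), the control law $\mathbf{u}=\mathbf{K}\mathbf{y}+\mathbf{p}$ with $\mathbf{K}=\Phi_u\Phi_y^{-1}$ and $\mathbf{p}=\phi_u-\mathbf{K}\phi_y$ achieves the closed-loop output-input response (R).
   Context: Here $x_t\in\mathbb{R}^n$, $u_t\in\mathbb{R}^m$, $y_t,e_t\in\mathbb{R}^q$, and $A,B,L,C,D$ are real matrices of compatible sizes, with $A-LC$ Schur stable. Stacked vectors: $\mathbf{y}=\mathrm{col}(y_0,\dots,y_T)$, $\mathbf{u}=\mathrm{col}(u_0,\dots,u_T)$, $\mathbf{e}=\mathrm{col}(e_0,\dots,e_T)$. The policy at time $t$ is $u_t=\sum_{k=0}^{t-1}K_{t,k}y_k+p_t$; thus $\mathbf{K}$ has $(t,k)$ block $K_{t,k}\in\mathbb{R}^{m\times q}$ for $k<t$ and zero blocks for $k\ge t$, and $\mathbf{p}=\mathrm{col}(p_0,\dots,p_T)$. All matrices are partitioned into $(T+1)\times(T+1)$ blocks (block size $q$ for output coordinates, $m$ for input coordinates). Block-lower-triangular means that the $(i,j)$ block is zero for $j>i$; block strictly-lower-triangular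 means that it is zero for $j\ge i$. Definitions: $\mathbf{C}=\mathrm{blkdiag}(C,\dots,C)$ and $\mathbf{D}=\mathrm{blkdiag}(D,\dots,D)$ ($T+1$ copies each); $\Gamma=\mathrm{col}(I,A,\dots,A^T)$; $\mathbf{T}_u$ has $(i,j)$ block $A^{i-j-1}B$ for $i>j$ and $0$ otherwise; $\mathbf{T}_e$ has $(i,j)$ block $A^{i-j-1}L$ for $i>j$ and $0$ otherwise ($0\le i,j\le T$). Then $\mathbf{G}=\mathbf{C}\mathbf{T}_u+\mathbf{D}$ (block-lower-triangular), $\Theta=\mathbf{C}\mathbf{T}_e+I$, and $\mathbf{y}_0=\mathbf{C}\Gamma\Psi\,\mathrm{col}(\mathbf{u}_0^-,\mathbf{y}_0^-)$, where, for a past horizon $\tau\in\mathbb{Z}_+$, $\mathbf{u}_0^-=\mathrm{col}(u_{-\tau},\dots,u_{-1})$, $\mathbf{y}_0^-=\mathrm{col}(y_{-\tau},\dots,y_{-1})$ are given past data and $\Psi=[\Psi^u_\tau,\dots,\Psi^u_1,\Psi^y_\tau,\dots,\Psi^y_1]$ with $\Psi^u_k=(A-LC)^{k-1}(B-LD)$, $\Psi^y_k=(A-LC)^{k-1}L$. The horizon $\tau$ is taken large enough that the remainder $(A-LC)^\tau x_{-\tau}$ in the expression of $x_0$ through past data is neglected, i.e. the system over the horizon is identified with $\mathbf{y}=\mathbf{G}\mathbf{u}+\mathbf{y}_0+\Theta\mathbf{e}$, where $\mathbf{e}\in\mathbb{R}^{q(T+1)}$ is arbitrary. The closed-loop output-input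 response of a policy $(\mathbf{K},\mathbf{p})$ is the map sending $\mathbf{e}$ to the unique $(\mathbf{y},\mathbf{u})$ with $\mathbf{y}=\mathbf{G}\mathbf{u}+\mathbf{y}_0+\Theta\mathbf{e}$ and $\mathbf{u}=\mathbf{K}\mathbf{y}+\mathbf{p}$. A policy achieves (R) if this $(\mathbf{y},\mathbf{u})$ equals the right-hand side of (R) for all $\mathbf{e}$. *)

theory Defs
  imports "Jordan_Normal_Form.Gauss_Jordan_Elimination" "Jordan_Normal_Form.Spectral_Radius"
begin

(* An M x N array of blocks, each of size r x c; block indices start at 0. *)
definition block_mat :: "nat \<Rightarrow> nat \<Rightarrow> nat \<Rightarrow> nat \<Rightarrow> (nat \<Rightarrow> nat \<Rightarrow> 'a mat) \<Rightarrow> 'a mat" where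
  "block_mat M N r c f =
     mat (M * r) (N * c) (\<lambda>(i, j). f (i div r) (j div c) $$ (i mod r, j mod c))"

definition block :: "nat \<Rightarrow> nat \<Rightarrow> 'a mat \<Rightarrow> nat \<Rightarrow> nat \<Rightarrow> 'a mat" where
  "block r c X i j = mat r c (\<lambda>(a, b). X $$ (i * r + a, j * c + b))"

definition block_vec :: "nat \<Rightarrow> nat \<Rightarrow> (nat \<Rightarrow> 'a vec) \<Rightarrow> 'a vec" where
  "block_vec N r f = vec (N * r) (\<lambda>i. f (i div r) $ (i mod r))"

definition blkdiag :: "nat \<Rightarrow> 'a :: zero mat \<Rightarrow> 'a mat" where
  "blkdiag N X = block_mat N N (dim_row X) (dim_col X)
     (\<lambda>i j. if i = j then X else 0\<^sub>m (dim_row X) (dim_col X))"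

definition block_lower_triangular :: "nat \<Rightarrow> nat \<Rightarrow> nat \<Rightarrow> 'a :: zero mat \<Rightarrow> bool" where
  "block_lower_triangular N r c X \<longleftrightarrow> X \<in> carrier_mat (N * r) (N * c) \<and>
     (\<forall>i<N. \<forall>j<N. j > i \<longrightarrow> block r c X i j = 0\<^sub>m r c)"

definition block_strictly_lower_triangular :: "nat \<Rightarrow> nat \<Rightarrow> nat \<Rightarrow> 'a :: zero mat \<Rightarrow> bool" where
  "block_strictly_lower_triangular N r c X \<longleftrightarrow> X \<in> carrier_mat (N * r) (N * c) \<and>
     (\<forall>i<N. \<forall>j<N. j \<ge> i \<longrightarrow> block r c X i j = 0\<^sub>m r c)"

definition append_cols :: "'a :: zero mat \<Rightarrow> 'a mat \<Rightarrow> 'a mat" (infixr \<open>@\<^sub>c\<close> 65) where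
  "X @\<^sub>c Y = four_block_mat X Y (0\<^sub>m 0 (dim_col X)) (0\<^sub>m 0 (dim_col Y))"

(* Stated through the spectrum rather than spectral_radius, which is a Max and hence
   unspecified for 0 x 0 matrices. *)
definition schur_stable :: "real mat \<Rightarrow> bool" where
  "schur_stable X \<longleftrightarrow> (\<forall>z \<in> spectrum (map_mat complex_of_real X). cmod z < 1)"

definition Gamma_mat :: "nat \<Rightarrow> real mat \<Rightarrow> real mat" where
  "Gamma_mat T A = block_mat (T + 1) 1 (dim_row A) (dim_row A) (\<lambda>i _. A ^\<^sub>m i)"

(* T_mat T A B and T_mat T A L are the maps from the stacked inputs and innovations to the
   stacked states. *)
definition T_mat :: "nat \<Rightarrow> real mat \<Rightarrow> real mat \<Rightarrow> real mat" where
  "T_mat T A X = block_mat (T + 1) (T + 1) (dim_row X) (dim_col X)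
     (\<lambda>i j. if i > j then A ^\<^sub>m (i - j - 1) * X else 0\<^sub>m (dim_row X) (dim_col X))"

definition G_mat :: "nat \<Rightarrow> real mat \<Rightarrow> real mat \<Rightarrow> real mat \<Rightarrow> real mat \<Rightarrow> real mat" where
  "G_mat T A B C D = blkdiag (T + 1) C * T_mat T A B + blkdiag (T + 1) D"

definition Theta_mat :: "nat \<Rightarrow> real mat \<Rightarrow> real mat \<Rightarrow> real mat \<Rightarrow> real mat" where
  "Theta_mat T A L C = blkdiag (T + 1) C * T_mat T A L + 1\<^sub>m ((T + 1) * dim_row C)"

definition Psi_u :: "real mat \<Rightarrow> real mat \<Rightarrow> real mat \<Rightarrow> real mat \<Rightarrow> real mat \<Rightarrow> nat \<Rightarrow> real mat" where
  "Psi_u A B L C D k = (A - L * C) ^\<^sub>m (k - 1) * (B - L * D)"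

definition Psi_y :: "real mat \<Rightarrow> real mat \<Rightarrow> real mat \<Rightarrow> nat \<Rightarrow> real mat" where
  "Psi_y A L C k = (A - L * C) ^\<^sub>m (k - 1) * L"

(* Block columns are in decreasing order k = tau, ..., 1, matching past_vec below. *)
definition Psi_mat ::
    "nat \<Rightarrow> real mat \<Rightarrow> real mat \<Rightarrow> real mat \<Rightarrow> real mat \<Rightarrow> real mat \<Rightarrow> real mat" where
  "Psi_mat \<tau> A B L C D =
     block_mat 1 \<tau> (dim_row B) (dim_col B) (\<lambda>_ j. Psi_u A B L C D (\<tau> - j)) @\<^sub>c
     block_mat 1 \<tau> (dim_row L) (dim_col L) (\<lambda>_ j. Psi_y A L C (\<tau> - j))"

(* col (w (-tau), ..., w (-1)) *)
definition past_vec :: "nat \<Rightarrow> nat \<Rightarrow> (int \<Rightarrow> real vec) \<Rightarrow> real vec" where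
  "past_vec \<tau> r w = block_vec \<tau> r (\<lambda>j. w (int j - int \<tau>))"

(* The contribution of the past data to the stacked output; the remainder
   (A - L C)^tau x_(-tau) in the expression of x_0 is dropped. *)
definition free_response :: "nat \<Rightarrow> nat \<Rightarrow> real mat \<Rightarrow> real mat \<Rightarrow> real mat \<Rightarrow> real mat \<Rightarrow> real mat
    \<Rightarrow> (int \<Rightarrow> real vec) \<Rightarrow> (int \<Rightarrow> real vec) \<Rightarrow> real vec" where
  "free_response T \<tau> A B L C D u_past y_past =
     (blkdiag (T + 1) C * Gamma_mat T A * Psi_mat \<tau> A B L C D) *\<^sub>v
       (past_vec \<tau> (dim_col B) u_past @\<^sub>v past_vec \<tau> (dim_row C) y_past)"

definition causal_policy :: "nat \<Rightarrow> nat \<Rightarrow> nat \<Rightarrow> real mat \<Rightarrow> real vec \<Rightarrow> bool" where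
  "causal_policy T m q K p \<longleftrightarrow>
     block_strictly_lower_triangular (T + 1) m q K \<and> p \<in> carrier_vec ((T + 1) * m)"

definition closed_loop :: "real mat \<Rightarrow> real mat \<Rightarrow> real vec \<Rightarrow> real mat \<Rightarrow> real vec \<Rightarrow> real vec
    \<Rightarrow> real vec \<times> real vec \<Rightarrow> bool" where
  "closed_loop G \<Theta> y0 K p e = (\<lambda>(y, u).
     y \<in> carrier_vec (dim_row G) \<and> u \<in> carrier_vec (dim_col G) \<and>
     y = G *\<^sub>v u + y0 + \<Theta> *\<^sub>v e \<and> u = K *\<^sub>v y + p)"

(* Meaningful only where the closed loop is well posed, which holds for every policy satisfying
   causal_policy when G is block-lower-triangular. *)
definition closed_loop_response :: "real mat \<Rightarrow> real mat \<Rightarrow> real vec \<Rightarrow> real mat \<Rightarrow> real vec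
    \<Rightarrow> real vec \<Rightarrow> real vec \<times> real vec" where
  "closed_loop_response G \<Theta> y0 K p e = (THE yu. closed_loop G \<Theta> y0 K p e yu)"

definition response_mat :: "real mat \<Rightarrow> real mat \<Rightarrow> real vec \<Rightarrow> real vec \<Rightarrow> real mat" where
  "response_mat \<Phi>y \<Phi>u \<phi>y \<phi>u =
     four_block_mat \<Phi>y (mat_of_cols (dim_vec \<phi>y) [\<phi>y]) \<Phi>u (mat_of_cols (dim_vec \<phi>u) [\<phi>u])"

definition response_carrier ::
    "nat \<Rightarrow> nat \<Rightarrow> nat \<Rightarrow> real mat \<Rightarrow> real mat \<Rightarrow> real vec \<Rightarrow> real vec \<Rightarrow> bool" where
  "response_carrier T m q \<Phi>y \<Phi>u \<phi>y \<phi>u \<longleftrightarrow>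
     \<Phi>y \<in> carrier_mat ((T + 1) * q) ((T + 1) * q) \<and>
     \<Phi>u \<in> carrier_mat ((T + 1) * m) ((T + 1) * q) \<and>
     \<phi>y \<in> carrier_vec ((T + 1) * q) \<and> \<phi>u \<in> carrier_vec ((T + 1) * m)"

definition cond_S :: "real mat \<Rightarrow> real mat \<Rightarrow> real mat \<Rightarrow> real vec \<Rightarrow> real vec \<Rightarrow> bool" where
  "cond_S G \<Phi>y \<Phi>u \<phi>y \<phi>u \<longleftrightarrow>
     (1\<^sub>m (dim_row G) @\<^sub>c (- G)) * response_mat \<Phi>y \<Phi>u \<phi>y \<phi>u =
     1\<^sub>m (dim_row G) @\<^sub>c 0\<^sub>m (dim_row G) 1"

definition cond_L :: "nat \<Rightarrow> nat \<Rightarrow> nat \<Rightarrow> real mat \<Rightarrow> real mat \<Rightarrow> bool" where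
  "cond_L T m q \<Phi>y \<Phi>u \<longleftrightarrow>
     block_lower_triangular (T + 1) q q \<Phi>y \<and> block_strictly_lower_triangular (T + 1) m q \<Phi>u"

definition achieves_R :: "real mat \<Rightarrow> real mat \<Rightarrow> real vec \<Rightarrow> real mat \<Rightarrow> real vec
    \<Rightarrow> real mat \<Rightarrow> real mat \<Rightarrow> real vec \<Rightarrow> real vec \<Rightarrow> bool" where
  "achieves_R G \<Theta> y0 K p \<Phi>y \<Phi>u \<phi>y \<phi>u \<longleftrightarrow>
     (\<forall>e \<in> carrier_vec (dim_row G). case closed_loop_response G \<Theta> y0 K p e of (y, u) \<Rightarrow>
        y @\<^sub>v u = response_mat \<Phi>y \<Phi>u \<phi>y \<phi>u *\<^sub>v ((y0 + \<Theta> *\<^sub>v e) @\<^sub>v vec 1 (\<lambda>_. 1)))"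

end

theory Submission
  imports Defs
begin

text \<open>
  Writing \<open>d = y0 + \<Theta> e\<close>, the closed loop is \<open>(I - G K) y = G p + d\<close>. Since \<open>G K\<close> is block
  strictly-lower-triangular, \<open>I - G K\<close> is unit lower triangular and its inverse \<open>M\<close> is
  block-lower-triangular; then \<open>\<Phi>y = M\<close>, \<open>\<Phi>u = K M\<close>, \<open>\<phi>y = M G p\<close>, \<open>\<phi>u = K M G p + p\<close>.
  Conversely (S) says \<open>\<Phi>y = I + G \<Phi>u\<close> and \<open>\<phi>y = G \<phi>u\<close>, so under (L) \<open>\<Phi>y\<close> is unit lower
  triangular too, and any \<open>K\<close>, \<open>p\<close> with \<open>K \<Phi>y = \<Phi>u\<close> and \<open>K \<phi>y + p = \<phi>u\<close> reproduce (R).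
  That (R) forces (S) uses that \<open>\<Theta>\<close> is invertible, so that \<open>d\<close> ranges over the whole space.
\<close>

section \<open>Block-triangular matrices\<close>

text \<open>Entry \<open>(a, b)\<close> lies in block \<open>(a div r, b div c)\<close> at offset
  \<open>(a mod r, b mod c)\<close>, so vanishing of blocks can be checked entrywise. The relation
  \<open>P\<close> is left open so that both triangular shapes are instances.\<close>

lemma blocks_zero_iff:
  fixes X :: "'a :: zero mat"
  assumes "X \<in> carrier_mat (N * r) (N * c)"
  shows "(\<forall>i<N. \<forall>j<N. P i j \<longrightarrow> block r c X i j = 0\<^sub>m r c) \<longleftrightarrow>
    (\<forall>a<N * r. \<forall>b<N * c. P (a div r) (b div c) \<longrightarrow> X $$ (a, b) = 0)" (is "?blocks \<longleftrightarrow> ?entries")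
proof
  assume blocks: ?blocks
  show ?entries
  proof (intro allI impI)
    fix a b assume a: "a < N * r" and b: "b < N * c" and P: "P (a div r) (b div c)"
    \<comment> \<open>An index below \<open>N * r\<close> can exist only for positive
      \<open>r\<close>, which keeps the \<open>mod\<close> offsets inside the block; for empty
      blocks there is nothing to show.\<close>
    have r: "r > 0" and c: "c > 0" using a b by (auto intro: gr0I)
    have "a div r < N" "b div c < N" using a b by (simp_all add: less_mult_imp_div_less)
    with blocks P have "block r c X (a div r) (b div c) = 0\<^sub>m r c" by blast
    then have "block r c X (a div r) (b div c) $$ (a mod r, b mod c) = 0" using r c by simp
    then show "X $$ (a, b) = 0" using r c by (simp add: block_def)
  qed
next
  assume entries: ?entries
  show ?blocks
  proof (intro allI impI eq_matI)
    fix i j a b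
    assume i: "i < N" and j: "j < N" and P: "P i j"
      and "a < dim_row (0\<^sub>m r c :: 'a mat)" "b < dim_col (0\<^sub>m r c :: 'a mat)"
    then have a: "a < r" and b: "b < c" by simp_all
    have "i * r + a < Suc i * r" "j * c + b < Suc j * c" using a b by simp_all
    moreover have "Suc i * r \<le> N * r" "Suc j * c \<le> N * c" using i j by (intro mult_le_mono1; simp)+
    ultimately have "i * r + a < N * r" "j * c + b < N * c" by linarith+
    then show "block r c X i j $$ (a, b) = (0\<^sub>m r c :: 'a mat) $$ (a, b)"
      using entries a b P by (simp add: block_def)
  qed (simp_all add: block_def)
qed

lemma block_lower_triangular_iff:
  "block_lower_triangular N r c X \<longleftrightarrow> X \<in> carrier_mat (N * r) (N * c) \<and>
    (\<forall>a<N * r. \<forall>b<N * c. a div r < b div c \<longrightarrow> X $$ (a, b) = 0)"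
  using blocks_zero_iff[of X N r c "\<lambda>i j. i < j"] by (auto simp: block_lower_triangular_def)

lemma block_strictly_lower_triangular_iff:
  "block_strictly_lower_triangular N r c X \<longleftrightarrow> X \<in> carrier_mat (N * r) (N * c) \<and>
    (\<forall>a<N * r. \<forall>b<N * c. a div r \<le> b div c \<longrightarrow> X $$ (a, b) = 0)"
  using blocks_zero_iff[of X N r c "\<lambda>i j. i \<le> j"]
  by (auto simp: block_strictly_lower_triangular_def)

lemma block_strictly_lower_imp_lower:
  "block_strictly_lower_triangular N r c X \<Longrightarrow> block_lower_triangular N r c X"
  by (simp add: block_strictly_lower_triangular_def block_lower_triangular_def)

section \<open>Products, sums and negatives of block-triangular matrices\<close>

lemma mult_mat_entry_zero:
  fixes X Y :: "'a :: semiring_0 mat"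
  assumes "X \<in> carrier_mat r s" "Y \<in> carrier_mat s c" "a < r" "b < c"
    and "\<And>k. k < s \<Longrightarrow> X $$ (a, k) = 0 \<or> Y $$ (k, b) = 0"
  shows "(X * Y) $$ (a, b) = 0"
proof -
  have "(X * Y) $$ (a, b) = (\<Sum>k<s. X $$ (a, k) * Y $$ (k, b))"
    using assms(1-4) by (auto simp: scalar_prod_def lessThan_atLeast0 intro!: sum.cong)
  also have "\<dots> = 0" using assms(5) by (intro sum.neutral) fastforce
  finally show ?thesis .
qed

text \<open>A nonzero term of the product at \<open>(a, b)\<close> needs the block of
  \<open>k\<close> to be at most that of \<open>a\<close> and strictly above that of
  \<open>b\<close>, hence the block of \<open>b\<close> lies strictly before that of
  \<open>a\<close>. The case split on \<open>k\<close> picks the factor that vanishes.\<close>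

lemma block_lower_mult_strictly_lower:
  fixes X Y :: "'a :: semiring_0 mat"
  assumes "block_lower_triangular N r s X" "block_strictly_lower_triangular N s c Y"
  shows "block_strictly_lower_triangular N r c (X * Y)"
  unfolding block_strictly_lower_triangular_iff
proof (intro conjI allI impI)
  fix a b assume "a < N * r" "b < N * c" "a div r \<le> b div c"
  moreover have "X $$ (a, k) = 0 \<or> Y $$ (k, b) = 0" if "k < N * s" for k
    using assms that calculation
    unfolding block_lower_triangular_iff block_strictly_lower_triangular_iff
    by (cases "a div r < k div s") auto
  ultimately show "(X * Y) $$ (a, b) = 0"
    using assms mult_mat_entry_zero[of X "N * r" "N * s" Y "N * c" a b]
    unfolding block_lower_triangular_iff block_strictly_lower_triangular_iff by blast
qed (use assms in \<open>auto simp: block_lower_triangular_def block_strictly_lower_triangular_def\<close>)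

lemma block_strictly_lower_mult_lower:
  fixes X Y :: "'a :: semiring_0 mat"
  assumes "block_strictly_lower_triangular N r s X" "block_lower_triangular N s c Y"
  shows "block_strictly_lower_triangular N r c (X * Y)"
  unfolding block_strictly_lower_triangular_iff
proof (intro conjI allI impI)
  fix a b assume "a < N * r" "b < N * c" "a div r \<le> b div c"
  moreover have "X $$ (a, k) = 0 \<or> Y $$ (k, b) = 0" if "k < N * s" for k
    using assms that calculation
    unfolding block_lower_triangular_iff block_strictly_lower_triangular_iff
    by (cases "a div r \<le> k div s") auto
  ultimately show "(X * Y) $$ (a, b) = 0"
    using assms mult_mat_entry_zero[of X "N * r" "N * s" Y "N * c" a b]
    unfolding block_lower_triangular_iff block_strictly_lower_triangular_iff by blast
qed (use assms in \<open>auto simp: block_lower_triangular_def block_strictly_lower_triangular_def\<close>)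

lemma block_lower_add:
  fixes X Y :: "'a :: monoid_add mat"
  assumes "block_lower_triangular N r c X" "block_lower_triangular N r c Y"
  shows "block_lower_triangular N r c (X + Y)"
  using assms by (auto simp: block_lower_triangular_iff)

lemma block_strictly_lower_uminus:
  fixes X :: "'a :: group_add mat"
  assumes "block_strictly_lower_triangular N r c X"
  shows "block_strictly_lower_triangular N r c (- X)"
  using assms by (auto simp: block_strictly_lower_triangular_iff)

section \<open>Triangular shape of the system matrices\<close>

lemma block_mat_carrier [simp]: "block_mat M N r c f \<in> carrier_mat (M * r) (N * c)"
  by (simp add: block_mat_def)

lemma block_lower_block_mat:
  assumes "\<And>i j. i < j \<Longrightarrow> f i j = 0\<^sub>m r c"
  shows "block_lower_triangular N r c (block_mat N N r c f)"
proof -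
  have "block_mat N N r c f $$ (a, b) = 0"
    if ab: "a < N * r" "b < N * c" "a div r < b div c" for a b
  proof -
    have "0 < r" "0 < c" using ab by (auto intro: gr0I)
    then show ?thesis using ab by (simp add: block_mat_def assms)
  qed
  then show ?thesis by (simp add: block_lower_triangular_iff)
qed

lemma block_strictly_lower_block_mat:
  assumes "\<And>i j. i \<le> j \<Longrightarrow> f i j = 0\<^sub>m r c"
  shows "block_strictly_lower_triangular N r c (block_mat N N r c f)"
proof -
  have "block_mat N N r c f $$ (a, b) = 0"
    if ab: "a < N * r" "b < N * c" "a div r \<le> b div c" for a b
  proof -
    have "0 < r" "0 < c" using ab by (auto intro: gr0I)
    then show ?thesis using ab by (simp add: block_mat_def assms)
  qed
  then show ?thesis by (simp add: block_strictly_lower_triangular_iff)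
qed

lemma block_lower_blkdiag:
  "X \<in> carrier_mat r c \<Longrightarrow> block_lower_triangular N r c (blkdiag N X)"
  by (auto simp: blkdiag_def intro!: block_lower_block_mat)

lemma block_strictly_lower_T_mat:
  assumes "X \<in> carrier_mat r c"
  shows "block_strictly_lower_triangular (T + 1) r c (T_mat T A X)"
  unfolding T_mat_def carrier_matD[OF assms] by (rule block_strictly_lower_block_mat) simp

text \<open>The dynamic part, \<open>blkdiag\<close> of \<open>C\<close> times \<open>T_mat\<close>,
  is strictly lower; the feedthrough \<open>D\<close> fills the diagonal blocks, so only the
  non-strict shape survives.\<close>

lemma block_lower_G_mat:
  assumes "B \<in> carrier_mat n m" "C \<in> carrier_mat q n" "D \<in> carrier_mat q m"
  shows "block_lower_triangular (T + 1) q m (G_mat T A B C D)"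
  unfolding G_mat_def
  using block_lower_add[OF block_strictly_lower_imp_lower[OF block_lower_mult_strictly_lower[OF
        block_lower_blkdiag[OF assms(2)] block_strictly_lower_T_mat[OF assms(1)]]]
      block_lower_blkdiag[OF assms(3)]] .

text \<open>Invertibility follows from the determinant being 1. The shape of the inverse is read off
  from M = I - X M by induction on the rows. The lemma serves for the loop matrix I - G K, for
  \<Theta> and for \<open>\<Phi>y\<close>.\<close>

lemma block_lower_unit_inverse:
  fixes X :: "'a :: field mat"
  assumes X: "block_strictly_lower_triangular N r r X"
  obtains M where "block_lower_triangular N r r M"
    "(1\<^sub>m (N * r) + X) * M = 1\<^sub>m (N * r)" "M * (1\<^sub>m (N * r) + X) = 1\<^sub>m (N * r)"
proof -
  let ?n = "N * r"
  have Xc: "X \<in> carrier_mat ?n ?n"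
    and X0: "\<And>a b. a < ?n \<Longrightarrow> b < ?n \<Longrightarrow> a div r \<le> b div r \<Longrightarrow> X $$ (a, b) = 0"
    using X by (auto simp: block_strictly_lower_triangular_iff)
  let ?U = "1\<^sub>m ?n + X"
  have U: "?U \<in> carrier_mat ?n ?n" using Xc by simp
  \<comment> \<open>Since \<open>div\<close> is monotone, block strictly-lower implies scalar
    strictly-lower; \<open>?U\<close> is therefore lower triangular with ones on the
    diagonal.\<close>
  have "det ?U = prod_list (diag_mat ?U)"
    using Xc X0 by (intro det_lower_triangular[OF _ U]) (simp add: div_le_mono)
  also have "diag_mat ?U = replicate ?n 1"
    using Xc X0 by (intro nth_equalityI) (simp_all add: diag_mat_def)
  finally have "det ?U \<noteq> 0" by simp
  from det_non_zero_imp_unit[OF U this] obtain M where Mc: "M \<in> carrier_mat ?n ?n"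
    and M: "M * ?U = 1\<^sub>m ?n" "?U * M = 1\<^sub>m ?n"
    by (auto simp: Units_def ring_mat_def)
  \<comment> \<open>This expresses row \<open>a\<close> of \<open>M\<close> through rows of strictly
    earlier blocks, because \<open>X\<close> vanishes on and above the diagonal blocks.\<close>
  have fix_eq: "M + X * M = 1\<^sub>m ?n"
    using M(2) Mc Xc by (simp add: add_mult_distrib_mat[of _ ?n ?n])
  have "\<forall>b<?n. a div r < b div r \<longrightarrow> M $$ (a, b) = 0" if "a < ?n" for a
    using that
  proof (induction a rule: less_induct)
    case (less a)
    show ?case
    proof (intro allI impI)
      fix b assume b: "b < ?n" and ab: "a div r < b div r"
      have "X $$ (a, k) = 0 \<or> M $$ (k, b) = 0" if k: "k < ?n" for k
      proof (cases "a div r \<le> k div r")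
        case True
        then show ?thesis using X0 less.prems k by simp
      next
        case False
        \<comment> \<open>Here \<open>k\<close> is in an earlier block row than \<open>a\<close>,
          hence also earlier than \<open>b\<close>, and the induction hypothesis annihilates the
          factor from \<open>M\<close>.\<close>
        then have "k < a" by (meson div_le_mono not_le)
        then show ?thesis using less.IH k b ab False by simp
      qed
      then have "(X * M) $$ (a, b) = 0"
        using mult_mat_entry_zero[OF Xc Mc less.prems b] by blast
      moreover have "(M + X * M) $$ (a, b) = 0"
        unfolding fix_eq using less.prems b ab by auto
      ultimately show "M $$ (a, b) = 0" using Xc Mc less.prems b by simp
    qed
  qed
  then have "block_lower_triangular N r r M" using Mc by (simp add: block_lower_triangular_iff)
  with M that show thesis by blast
qed

section \<open>Matrices and vectors in blocks\<close>

text \<open>Identifies the option-valued \<open>mat_inverse\<close> with a two-sided inverse already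
  at hand, whose triangular shape is known.\<close>

lemma mat_inverse_eq:
  fixes X M :: "'a :: field mat"
  assumes X: "X \<in> carrier_mat k k" and M: "M \<in> carrier_mat k k"
    and inv: "X * M = 1\<^sub>m k" "M * X = 1\<^sub>m k"
  shows "mat_inverse X = Some M"
proof (cases "mat_inverse X")
  case None
  \<comment> \<open>The last argument of \<open>ring_mat\<close> only fills the record extension, so
    any value will do.\<close>
  have "X \<in> Units (ring_mat TYPE('a) k undefined)"
    using X M inv by (auto simp: Units_def ring_mat_def)
  with mat_inverse(1)[OF X None, of undefined] show ?thesis by blast
next
  case (Some Y)
  from mat_inverse(2)[OF X Some] have Y: "Y \<in> carrier_mat k k" "Y * X = 1\<^sub>m k" by auto
  have "Y = Y * (X * M)" using Y inv by simp
  also have "\<dots> = M" using X Y M by (simp add: assoc_mult_mat[symmetric, of Y k k X k M k])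
  finally show ?thesis using Some by simp
qed

text \<open>With matching sizes, equal positions address equal blocks. Only the upper blocks are
  compared, since \<open>append_cols\<close> leaves the lower ones without rows.\<close>

lemma four_block_mat_inject:
  assumes eq: "four_block_mat X Y Z W = four_block_mat X' Y' Z' W'"
    and "X \<in> carrier_mat r c" "X' \<in> carrier_mat r c" "W \<in> carrier_mat s d" "W' \<in> carrier_mat s d"
    and "Y \<in> carrier_mat r d" "Y' \<in> carrier_mat r d"
  shows "X = X'" "Y = Y'"
proof -
  have *: "four_block_mat X Y Z W $$ (a, b) = four_block_mat X' Y' Z' W' $$ (a, b)" for a b
    using eq by simp
  show "X = X'"
  proof (rule eq_matI)
    fix a b assume "a < dim_row X'" "b < dim_col X'"
    then show "X $$ (a, b) = X' $$ (a, b)" using *[of a b] assms(2-) by simp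
  qed (use assms in auto)
  show "Y = Y'"
  proof (rule eq_matI)
    fix a b assume "a < dim_row Y'" "b < dim_col Y'"
    then show "Y $$ (a, b) = Y' $$ (a, b)" using *[of a "c + b"] assms(2-) by simp
  qed (use assms in auto)
qed

lemma mult_mat_of_col:
  assumes "X \<in> carrier_mat r c" "v \<in> carrier_vec c"
  shows "X * mat_of_cols c [v] = mat_of_cols r [X *\<^sub>v v]"
  using assms by (intro eq_matI) (auto simp: mat_of_cols_def scalar_prod_def)

lemma mat_of_col_mult_one:
  "v \<in> carrier_vec k \<Longrightarrow> mat_of_cols k [v] *\<^sub>v vec 1 (\<lambda>_. 1) = (v :: 'a :: semiring_1 vec)"
  by (intro eq_vecI) (auto simp: mat_of_cols_def scalar_prod_def)

lemma mat_of_col_inject: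
  assumes "mat_of_cols k [v] = mat_of_cols k [w]" "v \<in> carrier_vec k" "w \<in> carrier_vec k"
  shows "v = w"
proof -
  have "col (mat_of_cols k [u]) 0 = u" if "u \<in> carrier_vec k" for u :: "'a vec"
    using that col_mat_of_cols[of 0 "[u]" k] by simp
  from this[OF assms(2)] this[OF assms(3)] show ?thesis using assms(1) by metis
qed

lemma add_uminus_eq_mat_iff:
  fixes X Y Z :: "'a :: ab_group_add mat"
  assumes "X \<in> carrier_mat r c" "Y \<in> carrier_mat r c" "Z \<in> carrier_mat r c"
  shows "X + - Y = Z \<longleftrightarrow> X = Z + Y"
  using assms by (auto simp: mat_eq_iff diff_eq_eq)

lemma add_uminus_eq_zero_vec_iff:
  fixes v w :: "'a :: ab_group_add vec"
  assumes "v \<in> carrier_vec k" "w \<in> carrier_vec k"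
  shows "v + - w = 0\<^sub>v k \<longleftrightarrow> v = w"
  using assms by (auto simp: vec_eq_iff)

section \<open>Conditions (R) and (S) split into their blocks\<close>

lemma response_mat_mult:
  assumes \<Phi>y: "\<Phi>y \<in> carrier_mat r k" and \<Phi>u: "\<Phi>u \<in> carrier_mat s k"
    and \<phi>y: "\<phi>y \<in> carrier_vec r" and \<phi>u: "\<phi>u \<in> carrier_vec s" and d: "d \<in> carrier_vec k"
  shows "response_mat \<Phi>y \<Phi>u \<phi>y \<phi>u *\<^sub>v (d @\<^sub>v vec 1 (\<lambda>_. 1)) =
    (\<Phi>y *\<^sub>v d + \<phi>y) @\<^sub>v (\<Phi>u *\<^sub>v d + \<phi>u)"
proof -
  have cols: "mat_of_cols r [\<phi>y] \<in> carrier_mat r 1" "mat_of_cols s [\<phi>u] \<in> carrier_mat s 1"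
    using mat_of_cols_carrier(1)[of _ "[_]"] by simp_all
  show ?thesis
    unfolding response_mat_def carrier_vecD[OF \<phi>y] carrier_vecD[OF \<phi>u]
    unfolding four_block_mat_mult_vec[OF \<Phi>y cols(1) \<Phi>u cols(2) d vec_carrier]
    unfolding mat_of_col_mult_one[OF \<phi>y] mat_of_col_mult_one[OF \<phi>u] ..
qed

text \<open>Multiplying out the block row [I, -G] gives \<open>\<Phi>y\<close> - G
  \<open>\<Phi>u\<close> in the left block column and \<open>\<phi>y\<close> - G
  \<open>\<phi>u\<close> in the last column, to be compared with I and 0.\<close>

lemma cond_S_iff:
  assumes G: "G \<in> carrier_mat r s" and \<Phi>y: "\<Phi>y \<in> carrier_mat r r" and \<Phi>u: "\<Phi>u \<in> carrier_mat s r"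
    and \<phi>y: "\<phi>y \<in> carrier_vec r" and \<phi>u: "\<phi>u \<in> carrier_vec s"
  shows "cond_S G \<Phi>y \<Phi>u \<phi>y \<phi>u \<longleftrightarrow> \<Phi>y = 1\<^sub>m r + G * \<Phi>u \<and> \<phi>y = G *\<^sub>v \<phi>u"
proof -
  have cols: "mat_of_cols r [\<phi>y] \<in> carrier_mat r 1" "mat_of_cols s [\<phi>u] \<in> carrier_mat s 1"
    using mat_of_cols_carrier(1)[of _ "[_]"] by simp_all
  let ?P = "\<Phi>y + - (G * \<Phi>u)" and ?v = "\<phi>y + - (G *\<^sub>v \<phi>u)"
  have G\<Phi>u: "G * \<Phi>u \<in> carrier_mat r r" and P: "?P \<in> carrier_mat r r"
    using G \<Phi>y \<Phi>u by simp_all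
  have v: "mat_of_cols r [\<phi>y] + - G * mat_of_cols s [\<phi>u] = mat_of_cols r [?v]"
    using G \<phi>y \<phi>u cols mult_mat_of_col[OF G \<phi>u]
    by (intro eq_matI) (auto simp: mat_of_cols_def)
  \<comment> \<open>The product formula for four blocks is applied with a lower block row of height
    0.\<close>
  have lhs: "(1\<^sub>m r @\<^sub>c (- G)) * response_mat \<Phi>y \<Phi>u \<phi>y \<phi>u =
      four_block_mat ?P (mat_of_cols r [?v]) (0\<^sub>m 0 r) (0\<^sub>m 0 1)"
    unfolding append_cols_def response_mat_def v[symmetric]
    using assms cols
    by (subst mult_four_block_mat[of _ r r _ s _ 0]) simp_all
  have rhs: "1\<^sub>m r @\<^sub>c 0\<^sub>m r 1 =
      (four_block_mat (1\<^sub>m r) (mat_of_cols r [0\<^sub>v r]) (0\<^sub>m 0 r) (0\<^sub>m 0 1) :: real mat)"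
  proof -
    have "0\<^sub>m r 1 = (mat_of_cols r [0\<^sub>v r] :: real mat)"
      by (intro eq_matI) (auto simp: mat_of_cols_def)
    then show ?thesis by (simp add: append_cols_def)
  qed
  have "cond_S G \<Phi>y \<Phi>u \<phi>y \<phi>u \<longleftrightarrow> ?P = 1\<^sub>m r \<and> ?v = 0\<^sub>v r"
  proof
    assume "cond_S G \<Phi>y \<Phi>u \<phi>y \<phi>u"
    then have eq: "four_block_mat ?P (mat_of_cols r [?v]) (0\<^sub>m 0 r) (0\<^sub>m 0 1) =
        four_block_mat (1\<^sub>m r) (mat_of_cols r [0\<^sub>v r]) (0\<^sub>m 0 r) (0\<^sub>m 0 1)"
      unfolding cond_S_def carrier_matD(1)[OF G] lhs rhs .
    have carr: "mat_of_cols r [w] \<in> carrier_mat r 1" for w :: "real vec"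
      using mat_of_cols_carrier(1)[of r "[w]"] by simp
    note inj = four_block_mat_inject[OF eq P one_carrier_mat zero_carrier_mat zero_carrier_mat
        carr carr]
    have "?v = 0\<^sub>v r" using mat_of_col_inject[OF inj(2)] \<phi>y \<phi>u G by simp
    with inj(1) show "?P = 1\<^sub>m r \<and> ?v = 0\<^sub>v r" by blast
  next
    assume "?P = 1\<^sub>m r \<and> ?v = 0\<^sub>v r"
    then show "cond_S G \<Phi>y \<Phi>u \<phi>y \<phi>u"
      unfolding cond_S_def carrier_matD(1)[OF G] lhs rhs by (elim conjE) (simp only:)
  qed
  also have "?P = 1\<^sub>m r \<longleftrightarrow> \<Phi>y = 1\<^sub>m r + G * \<Phi>u"
    by (rule add_uminus_eq_mat_iff[OF \<Phi>y G\<Phi>u one_carrier_mat])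
  also have "?v = 0\<^sub>v r \<longleftrightarrow> \<phi>y = G *\<^sub>v \<phi>u"
    by (rule add_uminus_eq_zero_vec_iff[OF \<phi>y mult_mat_vec_carrier[OF G \<phi>u]])
  finally show ?thesis .
qed

text \<open>Unit vectors as test vectors recover the columns.\<close>

lemma mat_eq_by_mult_vec:
  fixes X Y :: "'a :: semiring_1 mat"
  assumes X: "X \<in> carrier_mat r c" and Y: "Y \<in> carrier_mat r c"
    and eq: "\<And>v. v \<in> carrier_vec c \<Longrightarrow> X *\<^sub>v v = Y *\<^sub>v v"
  shows "X = Y"
proof (rule eq_matI)
  fix i j assume "i < dim_row Y" "j < dim_col Y"
  then have "i < r" "j < c" using Y by simp_all
  then show "X $$ (i, j) = Y $$ (i, j)"
    using X Y arg_cong[OF eq[of "unit_vec c j"], of "\<lambda>v. v $ i"] by simp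
qed (use X Y in auto)

lemma add_vec_cancel:
  fixes v w x :: "'a :: ab_group_add vec"
  assumes "v + x = w + x" "v \<in> carrier_vec k" "w \<in> carrier_vec k" "x \<in> carrier_vec k"
  shows "v = w"
  using assms by (auto simp: vec_eq_iff)

lemma add_vec_right_commute:
  fixes v w x :: "'a :: ab_semigroup_add vec"
  assumes "v \<in> carrier_vec k" "w \<in> carrier_vec k" "x \<in> carrier_vec k"
  shows "v + w + x = v + x + w"
  using assms by (intro eq_vecI) (auto simp: ac_simps)

section \<open>Closed loops of the stacked system\<close>

text \<open>Abstracts the state-space data to the structure used in the loop algebra. \<Theta> is
  given as identity plus an explicit strictly lower part, the form that
  \<open>block_lower_unit_inverse\<close> accepts.\<close>

locale stacked_system =
  fixes T m q :: nat and G \<Theta> :: "real mat" and y0 :: "real vec"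
  assumes G_lower: "block_lower_triangular (T + 1) q m G"
    and \<Theta>_unit: "\<exists>X. block_strictly_lower_triangular (T + 1) q q X \<and>
      \<Theta> = 1\<^sub>m ((T + 1) * q) + X"
    and y0: "y0 \<in> carrier_vec ((T + 1) * q)"
begin

abbreviation "ny \<equiv> (T + 1) * q"
abbreviation "nu \<equiv> (T + 1) * m"

lemma G: "G \<in> carrier_mat ny nu"
  using G_lower by (simp only: block_lower_triangular_def)

lemma \<Theta>: "\<Theta> \<in> carrier_mat ny ny"
  using \<Theta>_unit by (auto simp only: block_strictly_lower_triangular_def intro!: add_carrier_mat)

lemma disturbance: "e \<in> carrier_vec ny \<Longrightarrow> y0 + \<Theta> *\<^sub>v e \<in> carrier_vec ny"
  by (rule add_carrier_vec[OF y0 mult_mat_vec_carrier[OF \<Theta>]])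

text \<open>The preimage is the inverse of \<Theta> applied to \<open>d - y0\<close>. It allows an
  identity known for all \<open>e\<close> to be evaluated at any chosen \<open>d\<close>, in
  particular at 0.\<close>

lemma disturbance_surj:
  assumes d: "d \<in> carrier_vec ny"
  obtains e where "e \<in> carrier_vec ny" "y0 + \<Theta> *\<^sub>v e = d"
proof -
  from \<Theta>_unit obtain X where X: "block_strictly_lower_triangular (T + 1) q q X"
    and \<Theta>_eq: "\<Theta> = 1\<^sub>m ny + X" by blast
  obtain M where "block_lower_triangular (T + 1) q q M" and inv: "\<Theta> * M = 1\<^sub>m ny"
    using block_lower_unit_inverse[OF X] unfolding \<Theta>_eq by metis
  then have M: "M \<in> carrier_mat ny ny" by (simp only: block_lower_triangular_def)
  have dy: "d - y0 \<in> carrier_vec ny" by (rule minus_carrier_vec[OF d y0])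
  have "\<Theta> *\<^sub>v (M *\<^sub>v (d - y0)) = d - y0"
    using assoc_mult_mat_vec[OF \<Theta> M dy] one_mult_mat_vec[OF dy] unfolding inv by simp
  moreover have "y0 + (d - y0) = d" using d y0 by (intro eq_vecI) auto
  ultimately show thesis using that[OF mult_mat_vec_carrier[OF M dy]] by simp
qed

section \<open>Existence and uniqueness of the closed-loop response\<close>

lemma policy_carrier:
  assumes "causal_policy T m q K p"
  shows "K \<in> carrier_mat nu ny" "p \<in> carrier_vec nu"
  using assms by (simp_all only: causal_policy_def block_strictly_lower_triangular_def)

lemma closed_loop_iff:
  assumes e: "e \<in> carrier_vec ny"
  shows "closed_loop G \<Theta> y0 K p e (y, u) \<longleftrightarrow> y \<in> carrier_vec ny \<and> u \<in> carrier_vec nu \<and>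
    y = G *\<^sub>v u + (y0 + \<Theta> *\<^sub>v e) \<and> u = K *\<^sub>v y + p"
proof -
  have "G *\<^sub>v u + y0 + \<Theta> *\<^sub>v e = G *\<^sub>v u + (y0 + \<Theta> *\<^sub>v e)" if "u \<in> carrier_vec nu" for u
    by (rule assoc_add_vec[OF mult_mat_vec_carrier[OF G that] y0 mult_mat_vec_carrier[OF \<Theta> e]])
  then show ?thesis
    unfolding closed_loop_def prod.case carrier_matD[OF G] by metis
qed

lemma cond_S_response:
  assumes "response_carrier T m q \<Phi>y \<Phi>u \<phi>y \<phi>u"
  shows "cond_S G \<Phi>y \<Phi>u \<phi>y \<phi>u \<longleftrightarrow> \<Phi>y = 1\<^sub>m ny + G * \<Phi>u \<and> \<phi>y = G *\<^sub>v \<phi>u"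
  using assms cond_S_iff[OF G] unfolding response_carrier_def by blast

text \<open>Substitution of the candidate into both loop equations: (S) yields the plant equation,
  the two relations between policy and response yield the control law. These relations are stated
  without an inverse so that they fit both a response built from a policy and a policy built from a
  response.\<close>

lemma closed_loop_solution:
  assumes K: "K \<in> carrier_mat nu ny" and p: "p \<in> carrier_vec nu"
    and resp: "response_carrier T m q \<Phi>y \<Phi>u \<phi>y \<phi>u"
    and S: "cond_S G \<Phi>y \<Phi>u \<phi>y \<phi>u"
    and K\<Phi>y: "K * \<Phi>y = \<Phi>u" and p_eq: "K *\<^sub>v \<phi>y + p = \<phi>u"
    and e: "e \<in> carrier_vec ny"
  defines "d \<equiv> y0 + \<Theta> *\<^sub>v e"
  shows "closed_loop G \<Theta> y0 K p e (\<Phi>y *\<^sub>v d + \<phi>y, \<Phi>u *\<^sub>v d + \<phi>u)"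
proof -
  have \<Phi>y: "\<Phi>y \<in> carrier_mat ny ny" and \<Phi>u: "\<Phi>u \<in> carrier_mat nu ny"
    and \<phi>y: "\<phi>y \<in> carrier_vec ny" and \<phi>u: "\<phi>u \<in> carrier_vec nu"
    using resp by (simp_all only: response_carrier_def)
  have d: "d \<in> carrier_vec ny" unfolding d_def by (rule disturbance[OF e])
  have S': "\<Phi>y = 1\<^sub>m ny + G * \<Phi>u" "\<phi>y = G *\<^sub>v \<phi>u"
    using S cond_S_response[OF resp] by blast+
  note yd = mult_mat_vec_carrier[OF \<Phi>y d] and ud = mult_mat_vec_carrier[OF \<Phi>u d]
  have "\<Phi>y *\<^sub>v d = d + G *\<^sub>v (\<Phi>u *\<^sub>v d)"
    unfolding S'(1) add_mult_distrib_mat_vec[OF one_carrier_mat mult_carrier_mat[OF G \<Phi>u] d]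
      one_mult_mat_vec[OF d] assoc_mult_mat_vec[OF G \<Phi>u d] ..
  also have "\<dots> = G *\<^sub>v (\<Phi>u *\<^sub>v d) + d"
    by (rule comm_add_vec[OF d mult_mat_vec_carrier[OF G ud]])
  finally have "\<Phi>y *\<^sub>v d + \<phi>y = G *\<^sub>v (\<Phi>u *\<^sub>v d) + d + G *\<^sub>v \<phi>u"
    using S'(2) by simp
  also have "\<dots> = G *\<^sub>v (\<Phi>u *\<^sub>v d + \<phi>u) + d"
    unfolding mult_add_distrib_mat_vec[OF G ud \<phi>u]
    by (rule add_vec_right_commute[OF mult_mat_vec_carrier[OF G ud] d
          mult_mat_vec_carrier[OF G \<phi>u]])
  finally have y: "\<Phi>y *\<^sub>v d + \<phi>y = G *\<^sub>v (\<Phi>u *\<^sub>v d + \<phi>u) + d" .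
  have "K *\<^sub>v (\<Phi>y *\<^sub>v d + \<phi>y) + p = \<Phi>u *\<^sub>v d + K *\<^sub>v \<phi>y + p"
    unfolding mult_add_distrib_mat_vec[OF K yd \<phi>y]
      assoc_mult_mat_vec[OF K \<Phi>y d, symmetric] K\<Phi>y ..
  also have "\<dots> = \<Phi>u *\<^sub>v d + \<phi>u"
    unfolding assoc_add_vec[OF ud mult_mat_vec_carrier[OF K \<phi>y] p] p_eq ..
  finally have u: "K *\<^sub>v (\<Phi>y *\<^sub>v d + \<phi>y) + p = \<Phi>u *\<^sub>v d + \<phi>u" .
  show ?thesis
    unfolding closed_loop_iff[OF e] d_def[symmetric]
    using y u[symmetric] add_carrier_vec[OF yd \<phi>y] add_carrier_vec[OF ud \<phi>u] by (intro conjI)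
qed

text \<open>\<open>M\<close> inverts I - G K, obtained with X = -G K. Its right-inverse property is
  recast as the first part of (S) with \<open>\<Phi>u\<close> = K M; the left-inverse property is
  kept for uniqueness.\<close>

lemma policy_loop_inverse:
  assumes "causal_policy T m q K p"
  obtains M where "block_lower_triangular (T + 1) q q M"
    "M = 1\<^sub>m ny + G * (K * M)" "M * (1\<^sub>m ny + - (G * K)) = 1\<^sub>m ny"
proof -
  note K = policy_carrier(1)[OF assms]
  have GK: "G * K \<in> carrier_mat ny ny" by (rule mult_carrier_mat[OF G K])
  have "block_strictly_lower_triangular (T + 1) q q (- (G * K))"
    using assms block_lower_mult_strictly_lower[OF G_lower] block_strictly_lower_uminus
    unfolding causal_policy_def by blast
  then obtain M where M: "block_lower_triangular (T + 1) q q M"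
      "(1\<^sub>m ny + - (G * K)) * M = 1\<^sub>m ny" "M * (1\<^sub>m ny + - (G * K)) = 1\<^sub>m ny"
    by (rule block_lower_unit_inverse)
  have Mc: "M \<in> carrier_mat ny ny" using M(1) by (simp only: block_lower_triangular_def)
  have uminus: "- (G * K) * M = - (G * K * M)"
    by (rule uminus_mult_left_mat) (simp only: carrier_matD[OF GK] carrier_matD[OF Mc])
  have "M + - (G * K * M) = 1\<^sub>m ny"
    using M(2) unfolding add_mult_distrib_mat[OF one_carrier_mat uminus_carrier_mat[OF GK] Mc]
      left_mult_one_mat[OF Mc] uminus .
  then have "M = 1\<^sub>m ny + G * (K * M)"
    unfolding add_uminus_eq_mat_iff[OF Mc mult_carrier_mat[OF GK Mc] one_carrier_mat]
    unfolding assoc_mult_mat[OF G K Mc] .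
  with M that show thesis by blast
qed

lemma closed_loop_unique:
  assumes policy: "causal_policy T m q K p" and e: "e \<in> carrier_vec ny"
    and sol1: "closed_loop G \<Theta> y0 K p e yu" and sol2: "closed_loop G \<Theta> y0 K p e yu'"
  shows "yu = yu'"
proof -
  note K = policy_carrier(1)[OF policy] and p = policy_carrier(2)[OF policy]
  have GK: "G * K \<in> carrier_mat ny ny" by (rule mult_carrier_mat[OF G K])
  let ?W = "1\<^sub>m ny + - (G * K)" and ?d = "y0 + \<Theta> *\<^sub>v e"
  have W: "?W \<in> carrier_mat ny ny" using GK by (simp only: add_carrier_mat uminus_carrier_mat)
  have d: "?d \<in> carrier_vec ny" by (rule disturbance[OF e])
  obtain M where "block_lower_triangular (T + 1) q q M" and MW: "M * ?W = 1\<^sub>m ny"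
    using policy_loop_inverse[OF policy] by metis
  then have M: "M \<in> carrier_mat ny ny" by (simp only: block_lower_triangular_def)
  \<comment> \<open>Eliminating \<open>u\<close> turns the loop into (I - G K) y = G p + d, which
    the left inverse \<open>M\<close> solves for \<open>y\<close>; \<open>u\<close> is then fixed by
    the policy.\<close>
  have y_eq: "y = M *\<^sub>v (G *\<^sub>v p + ?d)" if "closed_loop G \<Theta> y0 K p e (y, u)" for y u
  proof -
    have y: "y \<in> carrier_vec ny" and yG: "y = G *\<^sub>v u + ?d" and uK: "u = K *\<^sub>v y + p"
      using that unfolding closed_loop_iff[OF e] by blast+
    note Ky = mult_mat_vec_carrier[OF K y]
    have y': "y = G *\<^sub>v (K *\<^sub>v y) + G *\<^sub>v p + ?d"
      using yG unfolding uK mult_add_distrib_mat_vec[OF G Ky p] .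
    have "- (G * K) *\<^sub>v y = - (G * K *\<^sub>v y)"
      by (rule uminus_mult_mat_vec) (simp only: carrier_matD[OF GK] carrier_vecD[OF y])
    then have "?W *\<^sub>v y = y + - (G *\<^sub>v (K *\<^sub>v y))"
      unfolding add_mult_distrib_mat_vec[OF one_carrier_mat uminus_carrier_mat[OF GK] y]
        one_mult_mat_vec[OF y] assoc_mult_mat_vec[OF G K y] by (rule arg_cong)
    also have "\<dots> = G *\<^sub>v p + ?d"
    proof -
      have cancel: "a + b + c + - a = b + c"
        if "a \<in> carrier_vec ny" "b \<in> carrier_vec ny" "c \<in> carrier_vec ny" for a b c :: "real vec"
        using that by (intro eq_vecI) auto
      from cancel[OF mult_mat_vec_carrier[OF G Ky] mult_mat_vec_carrier[OF G p] d]
      show ?thesis using y' by metis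
    qed
    finally have "M *\<^sub>v (?W *\<^sub>v y) = M *\<^sub>v (G *\<^sub>v p + ?d)" by (rule arg_cong)
    then show ?thesis
      unfolding assoc_mult_mat_vec[OF M W y, symmetric] MW one_mult_mat_vec[OF y] .
  qed
  obtain y u y' u' where yu: "yu = (y, u)" "yu' = (y', u')" by (metis surj_pair)
  have "y = y'" using y_eq sol1 sol2 unfolding yu by metis
  moreover have "u = K *\<^sub>v y + p" "u' = K *\<^sub>v y' + p"
    using sol1 sol2 unfolding yu closed_loop_iff[OF e] by blast+
  ultimately show ?thesis unfolding yu by simp
qed

lemma policy_response:
  assumes policy: "causal_policy T m q K p"
  obtains \<Phi>y \<Phi>u \<phi>y \<phi>u where "response_carrier T m q \<Phi>y \<Phi>u \<phi>y \<phi>u"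
    "cond_S G \<Phi>y \<Phi>u \<phi>y \<phi>u" "cond_L T m q \<Phi>y \<Phi>u"
    "K * \<Phi>y = \<Phi>u" "K *\<^sub>v \<phi>y + p = \<phi>u"
proof -
  note K = policy_carrier(1)[OF policy] and p = policy_carrier(2)[OF policy]
  obtain M where M_lower: "block_lower_triangular (T + 1) q q M" and Meq: "M = 1\<^sub>m ny + G * (K * M)"
    using policy_loop_inverse[OF policy] by metis
  have M: "M \<in> carrier_mat ny ny" using M_lower by (simp only: block_lower_triangular_def)
  note KM = mult_carrier_mat[OF K M] and Gp = mult_mat_vec_carrier[OF G p]
  let ?\<phi>y = "M *\<^sub>v (G *\<^sub>v p)"
  have \<phi>y: "?\<phi>y \<in> carrier_vec ny" by (rule mult_mat_vec_carrier[OF M Gp])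
  note K\<phi>y = mult_mat_vec_carrier[OF K \<phi>y]
  have resp: "response_carrier T m q M (K * M) ?\<phi>y (K *\<^sub>v ?\<phi>y + p)"
    unfolding response_carrier_def using M KM \<phi>y add_carrier_vec[OF K\<phi>y p] by blast
  \<comment> \<open>Applying M = I + G K M to G p gives the affine part of (S).\<close>
  have "?\<phi>y = G *\<^sub>v p + G *\<^sub>v (K *\<^sub>v ?\<phi>y)"
    using arg_cong[OF Meq, of "\<lambda>X. X *\<^sub>v (G *\<^sub>v p)"]
    unfolding add_mult_distrib_mat_vec[OF one_carrier_mat mult_carrier_mat[OF G KM] Gp]
      one_mult_mat_vec[OF Gp] assoc_mult_mat_vec[OF G KM Gp] assoc_mult_mat_vec[OF K M Gp] .
  also have "\<dots> = G *\<^sub>v (K *\<^sub>v ?\<phi>y + p)"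
    unfolding mult_add_distrib_mat_vec[OF G K\<phi>y p]
    by (rule comm_add_vec[OF Gp mult_mat_vec_carrier[OF G K\<phi>y]])
  finally have "cond_S G M (K * M) ?\<phi>y (K *\<^sub>v ?\<phi>y + p)"
    using Meq cond_S_response[OF resp] by blast
  moreover have "cond_L T m q M (K * M)"
    using M_lower policy block_strictly_lower_mult_lower unfolding cond_L_def causal_policy_def by blast
  ultimately show thesis using that[OF resp _ _ refl refl] by blast
qed

text \<open>\<open>closed_loop_response\<close> is a \<open>THE\<close> description, so it can be
  evaluated only once existence and uniqueness are known.\<close>

lemma well_posed:
  assumes policy: "causal_policy T m q K p" and e: "e \<in> carrier_vec ny"
  shows "\<exists>!yu. closed_loop G \<Theta> y0 K p e yu"
proof (rule ex_ex1I)
  show "\<exists>yu. closed_loop G \<Theta> y0 K p e yu"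
    using policy_response[OF policy] closed_loop_solution[OF policy_carrier[OF policy] _ _ _ _ e]
    by metis
qed (rule closed_loop_unique[OF policy e])

lemma closed_loop_response_eq:
  assumes "causal_policy T m q K p" "e \<in> carrier_vec ny" "closed_loop G \<Theta> y0 K p e yu"
  shows "closed_loop_response G \<Theta> y0 K p e = yu"
  unfolding closed_loop_response_def by (rule the1_equality[OF well_posed[OF assms(1,2)] assms(3)])

section \<open>Passing between policies and responses\<close>

lemma achieves_R_I:
  assumes policy: "causal_policy T m q K p"
    and resp: "response_carrier T m q \<Phi>y \<Phi>u \<phi>y \<phi>u"
    and S: "cond_S G \<Phi>y \<Phi>u \<phi>y \<phi>u"
    and K\<Phi>y: "K * \<Phi>y = \<Phi>u" and p_eq: "K *\<^sub>v \<phi>y + p = \<phi>u"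
  shows "achieves_R G \<Theta> y0 K p \<Phi>y \<Phi>u \<phi>y \<phi>u"
  unfolding achieves_R_def carrier_matD(1)[OF G]
proof
  fix e :: "real vec" assume e: "e \<in> carrier_vec ny"
  note sol = closed_loop_solution[OF policy_carrier[OF policy] resp S K\<Phi>y p_eq e]
  show "case closed_loop_response G \<Theta> y0 K p e of (y, u) \<Rightarrow>
      y @\<^sub>v u = response_mat \<Phi>y \<Phi>u \<phi>y \<phi>u *\<^sub>v ((y0 + \<Theta> *\<^sub>v e) @\<^sub>v vec 1 (\<lambda>_. 1))"
    unfolding closed_loop_response_eq[OF policy e sol] prod.case
    using resp response_mat_mult[OF _ _ _ _ disturbance[OF e]]
    unfolding response_carrier_def by metis
qed

text \<open>Inserting (R) into the plant equation gives an identity affine in \<open>d\<close>. As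
  \<open>d\<close> is arbitrary, its constant and linear parts agree separately, and these are the
  two parts of (S).\<close>

lemma achieves_R_imp_cond_S:
  assumes policy: "causal_policy T m q K p"
    and resp: "response_carrier T m q \<Phi>y \<Phi>u \<phi>y \<phi>u"
    and R: "achieves_R G \<Theta> y0 K p \<Phi>y \<Phi>u \<phi>y \<phi>u"
  shows "cond_S G \<Phi>y \<Phi>u \<phi>y \<phi>u"
proof -
  have \<Phi>y: "\<Phi>y \<in> carrier_mat ny ny" and \<Phi>u: "\<Phi>u \<in> carrier_mat nu ny"
    and \<phi>y: "\<phi>y \<in> carrier_vec ny" and \<phi>u: "\<phi>u \<in> carrier_vec nu"
    using resp by (simp_all only: response_carrier_def)
  have eq: "\<Phi>y *\<^sub>v d + \<phi>y = G *\<^sub>v (\<Phi>u *\<^sub>v d) + G *\<^sub>v \<phi>u + d" if d: "d \<in> carrier_vec ny" for d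
  proof -
    obtain e where e: "e \<in> carrier_vec ny" and de: "y0 + \<Theta> *\<^sub>v e = d"
      by (rule disturbance_surj[OF d])
    obtain y u where yu: "closed_loop G \<Theta> y0 K p e (y, u)"
      using well_posed[OF policy e] by (metis surj_pair)
    then have y: "y \<in> carrier_vec ny" and yG: "y = G *\<^sub>v u + d"
      unfolding closed_loop_iff[OF e] de by blast+
    have "y @\<^sub>v u = response_mat \<Phi>y \<Phi>u \<phi>y \<phi>u *\<^sub>v (d @\<^sub>v vec 1 (\<lambda>_. 1))"
      using bspec[OF R[unfolded achieves_R_def carrier_matD(1)[OF G]] e]
      unfolding closed_loop_response_eq[OF policy e yu] prod.case de .
    then have "y @\<^sub>v u = (\<Phi>y *\<^sub>v d + \<phi>y) @\<^sub>v (\<Phi>u *\<^sub>v d + \<phi>u)"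
      unfolding response_mat_mult[OF \<Phi>y \<Phi>u \<phi>y \<phi>u d] .
    then have "y = \<Phi>y *\<^sub>v d + \<phi>y" "u = \<Phi>u *\<^sub>v d + \<phi>u"
      unfolding append_vec_eq[OF y add_carrier_vec[OF mult_mat_vec_carrier[OF \<Phi>y d] \<phi>y]] by blast+
    with yG show ?thesis
      using mult_add_distrib_mat_vec[OF G mult_mat_vec_carrier[OF \<Phi>u d] \<phi>u] by metis
  qed
  have G\<Phi>u: "G * \<Phi>u \<in> carrier_mat ny ny" and G\<phi>u: "G *\<^sub>v \<phi>u \<in> carrier_vec ny"
    by (rule mult_carrier_mat[OF G \<Phi>u], rule mult_mat_vec_carrier[OF G \<phi>u])
  have zero: "X *\<^sub>v 0\<^sub>v c = 0\<^sub>v r" if "X \<in> carrier_mat r c" for X :: "real mat" and r c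
    using that by (intro eq_vecI) auto
  have \<phi>y_eq: "\<phi>y = G *\<^sub>v \<phi>u"
    \<comment> \<open>The constant part is isolated at \<open>d\<close> = 0.\<close>
    using eq[OF zero_carrier_vec] left_zero_vec[OF \<phi>y] left_zero_vec[OF G\<phi>u] right_zero_vec[OF G\<phi>u]
    unfolding zero[OF \<Phi>y] zero[OF \<Phi>u] zero[OF G] by metis
  have "\<Phi>y = 1\<^sub>m ny + G * \<Phi>u"
  proof (rule mat_eq_by_mult_vec[OF \<Phi>y add_carrier_mat[OF G\<Phi>u]])
    fix d :: "real vec" assume d: "d \<in> carrier_vec ny"
    note ud = mult_mat_vec_carrier[OF G mult_mat_vec_carrier[OF \<Phi>u d]]
    have "\<Phi>y *\<^sub>v d + \<phi>y = d + G *\<^sub>v (\<Phi>u *\<^sub>v d) + \<phi>y"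
      using eq[OF d] add_vec_right_commute[OF ud G\<phi>u d] comm_add_vec[OF ud d] \<phi>y_eq by metis
    from add_vec_cancel[OF this mult_mat_vec_carrier[OF \<Phi>y d] add_carrier_vec[OF d ud] \<phi>y]
    show "\<Phi>y *\<^sub>v d = (1\<^sub>m ny + G * \<Phi>u) *\<^sub>v d"
      unfolding add_mult_distrib_mat_vec[OF one_carrier_mat G\<Phi>u d] one_mult_mat_vec[OF d]
        assoc_mult_mat_vec[OF G \<Phi>u d] .
  qed
  with \<phi>y_eq cond_S_response[OF resp] show ?thesis by blast
qed

text \<open>By (S) and (L), \<open>\<Phi>y\<close> is the identity plus the strictly lower G
  \<open>\<Phi>u\<close>, so its inverse is block-lower-triangular. Multiplying it by the strictly
  lower \<open>\<Phi>u\<close> keeps \<open>K\<close> strictly causal.\<close>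

lemma response_policy:
  assumes resp: "response_carrier T m q \<Phi>y \<Phi>u \<phi>y \<phi>u"
    and S: "cond_S G \<Phi>y \<Phi>u \<phi>y \<phi>u" and L: "cond_L T m q \<Phi>y \<Phi>u"
  defines "K \<equiv> \<Phi>u * the (mat_inverse \<Phi>y)"
  defines "p \<equiv> \<phi>u - K *\<^sub>v \<phi>y"
  shows "invertible_mat \<Phi>y" "causal_policy T m q K p" "achieves_R G \<Theta> y0 K p \<Phi>y \<Phi>u \<phi>y \<phi>u"
proof -
  have \<Phi>y: "\<Phi>y \<in> carrier_mat ny ny" and \<Phi>u: "\<Phi>u \<in> carrier_mat nu ny"
    and \<phi>y: "\<phi>y \<in> carrier_vec ny" and \<phi>u: "\<phi>u \<in> carrier_vec nu"
    using resp by (simp_all only: response_carrier_def)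
  have \<Phi>uL: "block_strictly_lower_triangular (T + 1) m q \<Phi>u" using L by (simp only: cond_L_def)
  have \<Phi>y_eq: "\<Phi>y = 1\<^sub>m ny + G * \<Phi>u" using S cond_S_response[OF resp] by blast
  obtain M where M_lower: "block_lower_triangular (T + 1) q q M"
      and M1: "\<Phi>y * M = 1\<^sub>m ny" and M2: "M * \<Phi>y = 1\<^sub>m ny"
    unfolding \<Phi>y_eq
    by (rule block_lower_unit_inverse[OF block_lower_mult_strictly_lower[OF G_lower \<Phi>uL]])
  have M: "M \<in> carrier_mat ny ny" using M_lower by (simp only: block_lower_triangular_def)
  show "invertible_mat \<Phi>y"
    unfolding invertible_mat_def inverts_mat_def square_mat.simps carrier_matD[OF \<Phi>y]
    using M1 M2 carrier_matD(1)[OF M] by metis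
  have K_eq: "K = \<Phi>u * M" unfolding K_def mat_inverse_eq[OF \<Phi>y M M1 M2] option.sel ..
  have K: "K \<in> carrier_mat nu ny" unfolding K_eq by (rule mult_carrier_mat[OF \<Phi>u M])
  note K\<phi>y = mult_mat_vec_carrier[OF K \<phi>y]
  have "p \<in> carrier_vec nu" unfolding p_def by (rule minus_carrier_vec[OF \<phi>u K\<phi>y])
  with block_strictly_lower_mult_lower[OF \<Phi>uL M_lower] show policy: "causal_policy T m q K p"
    unfolding causal_policy_def K_eq by blast
  have "K * \<Phi>y = \<Phi>u"
    unfolding K_eq assoc_mult_mat[OF \<Phi>u M \<Phi>y] M2 by (rule right_mult_one_mat[OF \<Phi>u])
  moreover have "v + (w - v) = w" if "v \<in> carrier_vec nu" "w \<in> carrier_vec nu" for v w :: "real vec"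
    using that by (intro eq_vecI) auto
  then have "K *\<^sub>v \<phi>y + p = \<phi>u" unfolding p_def using K\<phi>y \<phi>u by blast
  ultimately show "achieves_R G \<Theta> y0 K p \<Phi>y \<Phi>u \<phi>y \<phi>u"
    by (rule achieves_R_I[OF policy resp S])
qed

end

section \<open>The state-space system as an instance\<close>

lemma Theta_mat_unit:
  assumes L: "L \<in> carrier_mat n q" and C: "C \<in> carrier_mat q n"
  shows "\<exists>X. block_strictly_lower_triangular (T + 1) q q X \<and>
    Theta_mat T A L C = 1\<^sub>m ((T + 1) * q) + X"
proof (intro exI conjI)
  show "block_strictly_lower_triangular (T + 1) q q (blkdiag (T + 1) C * T_mat T A L)"
    by (rule block_lower_mult_strictly_lower[OF block_lower_blkdiag[OF C]
          block_strictly_lower_T_mat[OF L]])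
  then have "blkdiag (T + 1) C * T_mat T A L \<in> carrier_mat ((T + 1) * q) ((T + 1) * q)"
    by (simp only: block_strictly_lower_triangular_def)
  then show "Theta_mat T A L C = 1\<^sub>m ((T + 1) * q) + blkdiag (T + 1) C * T_mat T A L"
    unfolding Theta_mat_def carrier_matD(1)[OF C] by (rule comm_add_mat[OF _ one_carrier_mat])
qed

lemma free_response_carrier:
  assumes "C \<in> carrier_mat q n"
  shows "free_response T \<tau> A B L C D u_past y_past \<in> carrier_vec ((T + 1) * q)"
proof -
  have "blkdiag (T + 1) C \<in> carrier_mat ((T + 1) * q) ((T + 1) * n)"
    using block_lower_blkdiag[OF assms] unfolding block_lower_triangular_def by blast
  then show ?thesis
    unfolding free_response_def
    by (intro carrier_vecI) (simp only: dim_mult_mat_vec index_mult_mat(2) carrier_matD(1))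
qed

theorem theorem1:
  fixes n m q T \<tau> :: nat
    and A B L C D :: "real mat"
    and u_past y_past :: "int \<Rightarrow> real vec"
  assumes A: "A \<in> carrier_mat n n" and B: "B \<in> carrier_mat n m" and L: "L \<in> carrier_mat n q"
    and C: "C \<in> carrier_mat q n" and D: "D \<in> carrier_mat q m"
    and stable: "schur_stable (A - L * C)"
    and u_past: "\<forall>t \<in> {- int \<tau>..<0}. u_past t \<in> carrier_vec m"
    and y_past: "\<forall>t \<in> {- int \<tau>..<0}. y_past t \<in> carrier_vec q"
  defines "G \<equiv> G_mat T A B C D"
    and "\<Theta> \<equiv> Theta_mat T A L C"
    and "y0 \<equiv> free_response T \<tau> A B L C D u_past y_past"
  shows "(\<forall>K p. causal_policy T m q K p \<longrightarrow>
      (\<forall>e \<in> carrier_vec ((T + 1) * q). \<exists>!yu. closed_loop G \<Theta> y0 K p e yu))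
    \<and> (\<forall>K p. causal_policy T m q K p \<longrightarrow>
      (\<exists>\<Phi>y \<Phi>u \<phi>y \<phi>u. response_carrier T m q \<Phi>y \<Phi>u \<phi>y \<phi>u \<and>
         cond_S G \<Phi>y \<Phi>u \<phi>y \<phi>u \<and> cond_L T m q \<Phi>y \<Phi>u \<and>
         achieves_R G \<Theta> y0 K p \<Phi>y \<Phi>u \<phi>y \<phi>u))
    \<and> (\<forall>\<Phi>y \<Phi>u \<phi>y \<phi>u. response_carrier T m q \<Phi>y \<Phi>u \<phi>y \<phi>u \<longrightarrow>
      cond_L T m q \<Phi>y \<Phi>u \<longrightarrow>
      (\<exists>K p. causal_policy T m q K p \<and> achieves_R G \<Theta> y0 K p \<Phi>y \<Phi>u \<phi>y \<phi>u) \<longrightarrow>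
      cond_S G \<Phi>y \<Phi>u \<phi>y \<phi>u)
    \<and> (\<forall>\<Phi>y \<Phi>u \<phi>y \<phi>u. response_carrier T m q \<Phi>y \<Phi>u \<phi>y \<phi>u \<longrightarrow>
      cond_S G \<Phi>y \<Phi>u \<phi>y \<phi>u \<longrightarrow> cond_L T m q \<Phi>y \<Phi>u \<longrightarrow>
      invertible_mat \<Phi>y \<and>
      (let K = \<Phi>u * the (mat_inverse \<Phi>y); p = \<phi>u - K *\<^sub>v \<phi>y
       in causal_policy T m q K p \<and> achieves_R G \<Theta> y0 K p \<Phi>y \<Phi>u \<phi>y \<phi>u))"
proof -
  interpret stacked_system T m q G \<Theta> y0
    using block_lower_G_mat[OF B C D] Theta_mat_unit[OF L C] free_response_carrier[OF C]
    unfolding G_def \<Theta>_def y0_def by unfold_locales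
  show ?thesis
    unfolding Let_def
  proof (intro conjI allI impI ballI)
    fix K p assume policy: "causal_policy T m q K p"
    show "\<exists>!yu. closed_loop G \<Theta> y0 K p e yu" if "e \<in> carrier_vec ((T + 1) * q)" for e
      by (rule well_posed[OF policy that])
    show "\<exists>\<Phi>y \<Phi>u \<phi>y \<phi>u. response_carrier T m q \<Phi>y \<Phi>u \<phi>y \<phi>u \<and>
        cond_S G \<Phi>y \<Phi>u \<phi>y \<phi>u \<and> cond_L T m q \<Phi>y \<Phi>u \<and>
        achieves_R G \<Theta> y0 K p \<Phi>y \<Phi>u \<phi>y \<phi>u"
      using policy_response[OF policy] achieves_R_I[OF policy] by metis
  \<comment> \<open>What remains is the implication from (R) to (S) and the claims about the
    explicit controller.\<close>
  qed (use achieves_R_imp_cond_S response_policy in \<open>blast+\<close>)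
qed

end
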